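(* Let $n\ge 2$ and let $r_1,\dots,r_n\in[0,1)$. Consider a first-price auction with $n$ bidders in which each bidder $i$ has multiplicative price reduction rate $r_i$, and in which the valuations $v_1,\dots,v_n$ are independent with $v_i$ uniformly distributed on $[0,1-r_i]$. Then the bids $$b_i=\left(\frac{n-1}{n}\right)\left(\frac{1}{1-r_i}\right)v_i,\qquad i=1,\dots,n,$$ are Bayes-Nash equilibrium bids.
   Context: In the first-price auction with multiplicative price reduction rates $r_1,\dots,r_n$, each bidder $i$ submits a real bid $b_i$, the highest bid wins, and bidder $i$ pays $b_i(1-r_i)$ if they win. Bidder $i$'s utility is $z_i=p_i(\mathbf{b})\,(v_i-b_i(1-r_i))$, where $p_i(\mathbf{b})=1$ if $b_i>b_j$ for all $j\ne i$, $p_i(\mathbf{b})=0$ if $b_j>b_i$ for some $j$, and $p_i(\mathbf{b})=1/k$ if exactly $k$ bidders, including $i$, tie for the highest bid. Each bidder knows their own valuation and the distributions of the others' valuations. Bid functions $v_i\mapsto b_i(v_i)$, $i=1,\dots,n$, give Bayes-Nash equilibrium bids if, for each bidder $i$ and each valuation $v_i\in[0,1-r_i]$, the bid $b_i(v_i)$ maximizes over all bids $b\in\mathbb{R}$ the expected utility of bidder $i$ (expectation over the other bidders' valuations) when every other bidder $j\neq i$ bids $b_j(v_j)$. *)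

theory Defs
  imports "HOL-Probability.Probability"
begin

definition win_prob :: "nat \<Rightarrow> (nat \<Rightarrow> real) \<Rightarrow> nat \<Rightarrow> real" where
  "win_prob n b i =
    (if \<forall>j\<in>{1..n} - {i}. b j < b i then 1
     else if \<exists>j\<in>{1..n}. b i < b j then 0
     else 1 / real (card {j \<in> {1..n}. b j = b i}))"

definition utility :: "nat \<Rightarrow> (nat \<Rightarrow> real) \<Rightarrow> nat \<Rightarrow> real \<Rightarrow> (nat \<Rightarrow> real) \<Rightarrow> real" where
  "utility n r i v b = win_prob n b i * (v - b i * (1 - r i))"

(* Bidder i has valuation v and submits x, while every other bidder j submits \<beta> j (V j).
   The integrand does not depend on V i. The expectation is unconditional, which is the
   expectation given bidder i's own valuation when the valuations V are independent.
   For measurable bid functions \<beta> the integrand is bounded and measurable, so the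
   integral exists. *)
definition expected_utility ::
  "'w measure \<Rightarrow> nat \<Rightarrow> (nat \<Rightarrow> real) \<Rightarrow> (nat \<Rightarrow> 'w \<Rightarrow> real) \<Rightarrow> (nat \<Rightarrow> real \<Rightarrow> real)
    \<Rightarrow> nat \<Rightarrow> real \<Rightarrow> real \<Rightarrow> real" where
  "expected_utility M n r V \<beta> i v x =
    (\<integral>\<omega>. utility n r i v ((\<lambda>j. \<beta> j (V j \<omega>))(i := x)) \<partial>M)"

definition bayes_nash_equilibrium ::
  "'w measure \<Rightarrow> nat \<Rightarrow> (nat \<Rightarrow> real) \<Rightarrow> (nat \<Rightarrow> 'w \<Rightarrow> real) \<Rightarrow> (nat \<Rightarrow> real \<Rightarrow> real) \<Rightarrow> bool" where
  "bayes_nash_equilibrium M n r V \<beta> \<longleftrightarrow>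
    (\<forall>i\<in>{1..n}. \<forall>v\<in>{0..1 - r i}. \<forall>x.
      expected_utility M n r V \<beta> i v x \<le> expected_utility M n r V \<beta> i v (\<beta> i v))"

end

theory Submission
  imports Defs
begin

text \<open>Bidder \<open>j\<close>'s proposed bid is uniform on \<open>[0, c]\<close> with \<open>c = (n - 1) / n\<close>, for every \<open>r j\<close>.
  Ties are null events, so a bid \<open>x\<close> against the others wins with probability \<open>y ^ (n - 1)\<close>,
  where \<open>y\<close> is \<open>x / c\<close> clamped to \<open>[0, 1]\<close>. With \<open>w = v / (1 - r i)\<close> the expected utility is
  \<open>(1 - r i) (w - x) y ^ (n - 1)\<close>, which is at most \<open>(1 - r i) (w - c y) y ^ (n - 1)\<close> and hence,
  by AM-GM, at most \<open>(1 - r i) w ^ n / n\<close>. The bid \<open>x = c w\<close> attains this bound.\<close>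

text \<open>The distribution function of the uniform law on [0, 1].\<close>

definition clamp01 :: "real \<Rightarrow> real" where
  "clamp01 t = max 0 (min 1 t)"

text \<open>AM-GM for one copy of \<open>w ^ Suc m\<close> and \<open>m\<close> copies of
  \<open>y ^ Suc m\<close>. Inductively, right side minus left side at \<open>Suc m\<close> is
  \<open>w\<close> times that difference at \<open>m\<close>, plus a nonnegative multiple of
  \<open>(w - y)\<^sup>2\<close>.\<close>

lemma weighted_power_AM_GM:
  fixes w y :: real
  assumes "0 \<le> w" "0 \<le> y"
  shows "real (Suc m) * w * y ^ m \<le> w ^ Suc m + real m * y ^ Suc m"
proof (induction m)
  case (Suc m)
  have "0 \<le> w * (w ^ Suc m + real m * y ^ Suc m - real (Suc m) * w * y ^ m)"
    using Suc assms by simp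
  moreover have "0 \<le> real (Suc m) * y ^ m * (w - y)\<^sup>2"
    using assms by simp
  ultimately have "0 \<le> w * (w ^ Suc m + real m * y ^ Suc m - real (Suc m) * w * y ^ m)
      + real (Suc m) * y ^ m * (w - y)\<^sup>2"
    by (rule add_nonneg_nonneg)
  also have "\<dots> = w ^ Suc (Suc m) + real (Suc m) * y ^ Suc (Suc m)
      - real (Suc (Suc m)) * w * y ^ Suc m"
    by (simp add: algebra_simps power2_eq_square)
  finally show ?case by simp
qed simp

lemma clamped_payoff_le:
  fixes w x :: real
  assumes "n \<ge> 2" and "0 \<le> w"
  defines "c \<equiv> (real n - 1) / real n"
  shows "(w - x) * clamp01 (x / c) ^ (n - 1) \<le> w ^ n / real n"
proof -
  define y where "y = clamp01 (x / c)"
  obtain m where n: "n = Suc m" and m: "m > 0"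
    using assms(1) by (cases n) auto
  have c: "c > 0" and cn: "real n * c = real m"
    using assms(1) by (simp_all add: c_def n)
  have y: "0 \<le> y" by (simp add: y_def clamp01_def)
  have "(w - x) * y ^ m \<le> (w - c * y) * y ^ m"
  \<comment> \<open>A negative bid is below \<open>c * y = 0\<close>, but then both sides vanish
    because \<open>m > 0\<close>. Otherwise clamping can only lower \<open>x / c\<close>.\<close>
  proof (cases "x < 0")
    case True
    then have "y = 0"
      using c by (simp add: y_def clamp01_def divide_less_0_iff min_def)
    then show ?thesis using m by (simp add: zero_power)
  next
    case False
    then have "y \<le> x / c"
      using c by (simp add: y_def clamp01_def)
    then have "c * y \<le> x"
      using c by (simp add: field_simps)
    then show ?thesis using y by (intro mult_right_mono) auto
  qed
  also have "(w - c * y) * y ^ m \<le> w ^ n / real n"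
  proof -
    have "real n * ((w - c * y) * y ^ m) = real n * w * y ^ m - (real n * c) * y ^ Suc m"
      by (simp add: algebra_simps)
    also have "\<dots> \<le> w ^ n"
      using weighted_power_AM_GM[OF assms(2) y, of m] unfolding cn by (simp add: n)
    finally show ?thesis
      using assms(1) by (simp add: pos_le_divide_eq mult.commute)
  qed
  finally show ?thesis
    by (simp add: y_def n)
qed

lemma measure_uniform_lessThan:
  fixes a s :: real
  assumes "a > 0"
  shows "measure (uniform_measure lborel {0..a}) {..<s} = clamp01 (s / a)"
proof -
  have "measure (uniform_measure lborel {0..a}) {..<s} = measure lborel ({0..a} \<inter> {..<s}) / a"
    using assms by (subst measure_uniform_measure) auto
  also have "{0..a} \<inter> {..<s} = (if s \<le> a then {0..<s} else {0..a})"
    by auto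
  finally show ?thesis
    using assms by (auto simp: clamp01_def max_def min_def field_simps split: if_splits)
qed

text \<open>A rival who is not beaten bids strictly more, so the branch that shares the win is never
  reached.\<close>

lemma win_prob_no_ties:
  assumes "i \<in> {1..n}" and "\<And>j. j \<in> {1..n} - {i} \<Longrightarrow> b j \<noteq> b i"
  shows "win_prob n b i = (if \<forall>j\<in>{1..n} - {i}. b j < b i then 1 else 0)"
proof -
  have "\<exists>j\<in>{1..n}. b i < b j" if "\<not> (\<forall>j\<in>{1..n} - {i}. b j < b i)"
    using that assms(2) by (meson DiffD1 linorder_neqE_linordered_idom)
  then show ?thesis by (auto simp: win_prob_def)
qed

lemma measurable_win_prob [measurable]:
  assumes [measurable]: "\<And>j. j \<in> {1..n} \<Longrightarrow> (\<lambda>\<omega>. b \<omega> j) \<in> borel_measurable M"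
    and i: "i \<in> {1..n}"
  shows "(\<lambda>\<omega>. win_prob n (b \<omega>) i) \<in> borel_measurable M"
proof -
  have [measurable]: "(\<lambda>\<omega>. b \<omega> i) \<in> borel_measurable M" using i by measurable
  \<comment> \<open>The set being counted varies with the outcome; as a finite sum of indicators its
    size is visibly measurable.\<close>
  have card: "real (card {j \<in> {1..n}. f j = f i}) = (\<Sum>j\<in>{1..n}. if f j = f i then 1 else 0)"
    for f :: "nat \<Rightarrow> real"
    by (simp flip: sum.inter_filter)
  show ?thesis
    unfolding win_prob_def card by measurable
qed

lemma expected_utility_eq:
  assumes r: "\<And>i. i \<in> {1..n} \<Longrightarrow> r i < 1"
    and "prob_space M"
    and indep: "prob_space.indep_vars M (\<lambda>_. borel) V {1..n}"
    and distr: "\<And>i. i \<in> {1..n} \<Longrightarrow> distr M borel (V i) = uniform_measure lborel {0..1 - r i}"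
    and c: "c > 0" and i: "i \<in> {1..n}" and n: "n \<ge> 2"
  shows "expected_utility M n r V (\<lambda>j v. c * (1 / (1 - r j)) * v) i v x =
    (v - x * (1 - r i)) * clamp01 (x / c) ^ (n - 1)"
proof -
  interpret prob_space M by fact
  let ?J = "{1..n} - {i}"
  define B where "B \<omega> = (\<lambda>j. c * (1 / (1 - r j)) * V j \<omega>)(i := x)" for \<omega>
  \<comment> \<open>The valuation at which rival \<open>j\<close> would bid exactly
    \<open>x\<close>. It is the fraction \<open>x / c\<close> of the range of \<open>V j\<close>, so
    the rates cancel and all rivals are beaten with equal probability.\<close>
  define S where "S j = x / c * (1 - r j)" for j
  define E where "E = (\<Inter>j\<in>?J. V j -` {..<S j} \<inter> space M)"
  have V [measurable]: "\<And>j. j \<in> {1..n} \<Longrightarrow> V j \<in> borel_measurable M"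
    using indep by (auto simp: indep_vars_def)
  have B_less: "B \<omega> j < B \<omega> i \<longleftrightarrow> V j \<omega> < S j"
    and B_eq: "B \<omega> j = B \<omega> i \<longleftrightarrow> V j \<omega> = S j" if "j \<in> ?J" for j \<omega>
    using that r[of j] c by (auto simp: B_def S_def field_simps)
  \<comment> \<open>Over an empty index set the intersection \<open>E\<close> would be
    \<open>UNIV\<close> instead of \<open>space M\<close>.\<close>
  have J: "?J \<noteq> {}"
  proof -
    have "card ?J = n - 1" using i by simp
    then show ?thesis using n by (metis card.empty One_nat_def diff_is_0_eq not_less_eq_eq numeral_2_eq_2)
  qed
  have E [measurable]: "E \<in> sets M"
    unfolding E_def using J by (intro sets.finite_INT) auto
  have "prob E = (\<Prod>j\<in>?J. prob (V j -` {..<S j} \<inter> space M))"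
    unfolding E_def using J by (intro indep_varsD[OF indep]) auto
  also have "\<dots> = (\<Prod>j\<in>?J. clamp01 (x / c))"
  proof (rule prod.cong)
    fix j assume j: "j \<in> ?J"
    have "prob (V j -` {..<S j} \<inter> space M) = measure (distr M borel (V j)) {..<S j}"
      using j by (subst measure_distr) auto
    also have "\<dots> = clamp01 (x / c)"
      using j r[of j] by (subst distr, simp, subst measure_uniform_lessThan) (auto simp: S_def)
    finally show "prob (V j -` {..<S j} \<inter> space M) = clamp01 (x / c)" .
  qed simp
  finally have prob_E: "prob E = clamp01 (x / c) ^ (n - 1)"
    using i by simp
  \<comment> \<open>The uniform law has no atoms, and there are finitely many rivals.\<close>
  have no_ties: "AE \<omega> in M. \<forall>j\<in>?J. V j \<omega> \<noteq> S j"
  proof (rule AE_finite_allI)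
    fix j assume j: "j \<in> ?J"
    have "AE t in distr M borel (V j). t \<noteq> S j"
      using j AE_lborel_singleton[of "S j"] by (subst distr) (auto intro!: AE_uniform_measureI)
    then show "AE \<omega> in M. V j \<omega> \<noteq> S j"
      using j by (subst (asm) AE_distr_iff) auto
  qed simp
  have "AE \<omega> in M. win_prob n (B \<omega>) i = indicator E \<omega>"
    using no_ties AE_space
  proof eventually_elim
    case (elim \<omega>)
    then show ?case
      using i J by (subst win_prob_no_ties) (auto simp: B_less B_eq E_def indicator_def)
  qed
  \<comment> \<open>\<open>M\<close> need not be complete, so almost sure equality with an indicator
    does not by itself give measurability.\<close>
  moreover have [measurable]: "(\<lambda>\<omega>. win_prob n (B \<omega>) i) \<in> borel_measurable M"
  proof (rule measurable_win_prob[OF _ i])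
    show "(\<lambda>\<omega>. B \<omega> j) \<in> borel_measurable M" if "j \<in> {1..n}" for j
      using that by (cases "j = i") (auto simp: B_def)
  qed
  ultimately have "(\<integral>\<omega>. win_prob n (B \<omega>) i \<partial>M) = (\<integral>\<omega>. indicator E \<omega> \<partial>M)"
    by (intro integral_cong_AE) auto
  then have win: "(\<integral>\<omega>. win_prob n (B \<omega>) i \<partial>M) = prob E"
    by simp
  have B_i: "B \<omega> i = x" for \<omega> by (simp add: B_def)
  have "expected_utility M n r V (\<lambda>j v. c * (1 / (1 - r j)) * v) i v x =
      (\<integral>\<omega>. utility n r i v (B \<omega>) \<partial>M)"
    by (simp only: expected_utility_def B_def)
  also have "\<dots> = (v - x * (1 - r i)) * prob E"
    by (simp add: utility_def B_i win)
  finally show ?thesis by (simp only: prob_E)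
qed

theorem theorem3p2:
  fixes M :: "'w measure" and n :: nat and r :: "nat \<Rightarrow> real" and V :: "nat \<Rightarrow> 'w \<Rightarrow> real"
  assumes "n \<ge> 2"
    and "\<And>i. i \<in> {1..n} \<Longrightarrow> 0 \<le> r i \<and> r i < 1"
    and "prob_space M"
    and "prob_space.indep_vars M (\<lambda>_. borel) V {1..n}"
    and "\<And>i. i \<in> {1..n} \<Longrightarrow> distr M borel (V i) = uniform_measure lborel {0..1 - r i}"
  shows "bayes_nash_equilibrium M n r V
    (\<lambda>i v. ((real n - 1) / real n) * (1 / (1 - r i)) * v)"
  unfolding bayes_nash_equilibrium_def
proof (intro ballI allI)
  fix i v x
  assume i: "i \<in> {1..n}" and v: "v \<in> {0..1 - r i}"
  define c where "c = (real n - 1) / real n"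
  define w where "w = v / (1 - r i)"
  have ri: "1 - r i > 0" using assms(2)[OF i] by simp
  have c: "c > 0" using assms(1) by (simp add: c_def)
  have w: "0 \<le> w" "w \<le> 1" and v_eq: "v = w * (1 - r i)"
    using v ri by (simp_all add: w_def)
  let ?U = "expected_utility M n r V (\<lambda>j v. c * (1 / (1 - r j)) * v) i v"
  \<comment> \<open>Measuring the valuation as the fraction \<open>w\<close> of its range makes
    \<open>r i\<close> a positive outer factor.\<close>
  have U: "?U z = (1 - r i) * ((w - z) * clamp01 (z / c) ^ (n - 1))" for z
    using expected_utility_eq[OF _ assms(3-5) c i assms(1), of v z] assms(2)
    by (simp add: v_eq algebra_simps)
  have "?U x \<le> (1 - r i) * (w ^ n / real n)"
    unfolding U using clamped_payoff_le[OF assms(1) w(1), of x] ri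
    by (intro mult_left_mono) (auto simp flip: c_def)
  \<comment> \<open>The equality case \<open>y = w\<close> of AM-GM, since
    \<open>w - c * w = w / n\<close>.\<close>
  also have "w ^ n / real n = (w - c * w) * w ^ (n - 1)"
    using assms(1) by (cases n) (auto simp: c_def field_simps)
  \<comment> \<open>Here \<open>v \<le> 1 - r i\<close> matters: it gives \<open>w \<le> 1\<close>,
    so clamping leaves \<open>w\<close> unchanged.\<close>
  also have "(1 - r i) * \<dots> = ?U (c * w)"
    unfolding U using w c by (simp add: clamp01_def)
  also have "c * w = c * (1 / (1 - r i)) * v"
    by (simp add: w_def)
  finally show "expected_utility M n r V (\<lambda>j v. (real n - 1) / real n * (1 / (1 - r j)) * v) i v x
      \<le> expected_utility M n r V (\<lambda>j v. (real n - 1) / real n * (1 / (1 - r j)) * v) i v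
          ((real n - 1) / real n * (1 / (1 - r i)) * v)"
    unfolding c_def .
qed

end
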